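(* Let $Q(v_a,v_b,v_c,v_d)$ be a hyperbolic Lambert quadrilateral in the unit disk $\mathbb{B}^2$, and let the quadruple of interior angles $(\frac{\pi}{2},\frac{\pi}{2},\phi,\frac{\pi}{2})$, $\phi\in[0,\pi/2)$, correspond to the quadruple $(v_a,v_b,v_c,v_d)$ of vertices. Let $d_1=d_\rho(J[v_a,v_d],J[v_b,v_c])$, $d_2=d_\rho(J[v_a,v_b],J[v_c,v_d])$, and let $L=\tanh\rho(v_a,v_c)\in(0,1]$. Then $$\tanh^2d_1+\tanh^2d_2=L^2.$$
   Context: $\mathbb{B}^2$ is the open unit disk in the plane with the hyperbolic metric $\rho$ of weight $2/(1-|x|^2)$, i.e. $\tanh\frac{\rho(x,y)}{2}=\frac{|x-y|}{\sqrt{|x-y|^2+(1-|x|^2)(1-|y|^2)}}$. Hyperbolic geodesic lines are the sets $C\cap\mathbb{B}^2$ where $C$ is a circle perpendicular to the unit circle or a Euclidean line through $0$. $J[a,b]$ is the hyperbolic geodesic segment joining $a$ and $b$ when $a,b\in\mathbb{B}^2$, or the hyperbolic geodesic ray when one of the two points is on $\partial\mathbb{B}^2$. For nonempty $A,B\subset\mathbb{B}^2$, $d_\rho(A,B)=\inf_{x\in A,\,y\in B}\rho(x,y)$. A hyperbolic quadrilateral $Q(a,b,c,d)$ is given by four points of the closed unit disk such that the hyperbolic geodesics joining $\{a,b\},\{b,c\},\{c,d\},\{d,a\}$ bound a domain $D\subset\mathbb{B}^2$ with $a,b,c,d$ in positive order on the boundary of $D$. It is a Lambert quadrilateral if its angles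 are $\pi/2,\pi/2,\pi/2,\phi$ with $0\le\phi<\pi/2$; the vertex with angle $\phi$ may be on the unit circle, in which case $\phi=0$. If $v_c\in\partial\mathbb{B}^2$, then $\rho(v_a,v_c)=\infty$ and $L=1$. *)

theory Defs
  imports "HOL-Complex_Analysis.Complex_Analysis"
begin

text \<open>
  The unit disk is \<^term>\<open>ball 0 1 :: complex set\<close>.  The metric below has weight
  \<open>2 / (1 - |x|^2)\<close>: it is the one with
  \<open>tanh (rho(x,y) / 2) = |x - y| / sqrt (|x - y|^2 + (1 - |x|^2) (1 - |y|^2))\<close>.
  It is only meaningful for points of the open disk (\<open>artanh 1 = 0\<close> here, whereas a point on
  the unit circle is at infinite distance).
\<close>

definition hyp_dist :: "complex \<Rightarrow> complex \<Rightarrow> real" where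
  "hyp_dist x y =
     2 * artanh (cmod (x - y) /
       sqrt ((cmod (x - y))\<^sup>2 + (1 - (cmod x)\<^sup>2) * (1 - (cmod y)\<^sup>2)))"

definition hyp_setdist :: "complex set \<Rightarrow> complex set \<Rightarrow> real" where
  "hyp_setdist A B = Inf {hyp_dist x y | x y. x \<in> A \<and> y \<in> B}"

text \<open>
  Two circles are perpendicular if they meet and their radii are orthogonal at every common point.
\<close>

definition perp_unit_circle :: "complex set \<Rightarrow> bool" where
  "perp_unit_circle C \<longleftrightarrow>
     (\<exists>p r. 0 < r \<and> C = sphere p r \<and> C \<inter> sphere 0 1 \<noteq> {} \<and>
            (\<forall>z \<in> C \<inter> sphere 0 1. orthogonal (z - p) z))"

definition hyp_line :: "complex set \<Rightarrow> bool" where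
  "hyp_line l \<longleftrightarrow>
     (\<exists>C. (perp_unit_circle C \<or> (\<exists>u. u \<noteq> 0 \<and> C = span {u})) \<and> l = C \<inter> ball 0 1)"

text \<open>
  Parametrized geodesic arcs joining two distinct points of the closed disk.  The closure of a
  geodesic line adds its two end points on the unit circle, so that either end of the arc may
  lie there.
\<close>

definition hyp_arc :: "complex \<Rightarrow> complex \<Rightarrow> (real \<Rightarrow> complex) \<Rightarrow> bool" where
  "hyp_arc a b g \<longleftrightarrow>
     arc g \<and> pathstart g = a \<and> pathfinish g = b \<and>
     (\<exists>l. hyp_line l \<and> path_image g \<subseteq> closure l)"

text \<open>
  The segment or ray \<open>J[a,b]\<close>, as a subset of the open disk: an end point on the unit circle
  does not belong to it.
\<close>

definition hyp_seg :: "complex \<Rightarrow> complex \<Rightarrow> complex set" where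
  "hyp_seg a b = {z \<in> ball 0 1. \<exists>g. hyp_arc a b g \<and> z \<in> path_image g}"

text \<open>
  Positive order of the vertices means that the boundary, traversed along
  \<open>a, b, c, d, a\<close>, winds once counterclockwise around the points of the domain.
\<close>

definition hyp_quadrilateral :: "complex \<Rightarrow> complex \<Rightarrow> complex \<Rightarrow> complex \<Rightarrow> bool" where
  "hyp_quadrilateral a b c d \<longleftrightarrow>
     {a, b, c, d} \<subseteq> cball 0 1 \<and>
     (\<exists>D g1 g2 g3 g4.
        hyp_arc a b g1 \<and> hyp_arc b c g2 \<and> hyp_arc c d g3 \<and> hyp_arc d a g4 \<and>
        open D \<and> connected D \<and> D \<noteq> {} \<and> D \<subseteq> ball 0 1 \<and>
        simple_path (g1 +++ g2 +++ g3 +++ g4) \<and>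
        frontier D = path_image (g1 +++ g2 +++ g3 +++ g4) \<and>
        (\<forall>z \<in> D. winding_number (g1 +++ g2 +++ g3 +++ g4) z = 1))"

text \<open>The unit tangent vector at \<open>v\<close> of the geodesic from \<open>v\<close> to \<open>w\<close>.\<close>

definition hyp_dir :: "complex \<Rightarrow> complex \<Rightarrow> complex" where
  "hyp_dir v w = Lim (at v within hyp_seg v w) (\<lambda>z. sgn (z - v))"

text \<open>
  The interior angle, in \<open>[0, 2 pi)\<close>, at the vertex \<open>v\<close> of a positively ordered polygon, where
  \<open>u\<close> precedes and \<open>w\<close> follows \<open>v\<close>.  The interior lies to the left of the side from \<open>v\<close> to
  \<open>w\<close>, so the angle is that of the counterclockwise rotation from this side to the side from
  \<open>v\<close> to \<open>u\<close>.  Hyperbolic and Euclidean angles agree since the metric is conformal.  At a vertex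
  on the unit circle both tangent vectors equal \<open>-v\<close>, and the angle is 0.
\<close>

definition hyp_angle :: "complex \<Rightarrow> complex \<Rightarrow> complex \<Rightarrow> real" where
  "hyp_angle u v w = Arg2pi (hyp_dir v u / hyp_dir v w)"

definition quad_angles :: "complex \<Rightarrow> complex \<Rightarrow> complex \<Rightarrow> complex \<Rightarrow> real list" where
  "quad_angles a b c d = [hyp_angle d a b, hyp_angle a b c, hyp_angle b c d, hyp_angle c d a]"

definition lambert_quadrilateral :: "complex \<Rightarrow> complex \<Rightarrow> complex \<Rightarrow> complex \<Rightarrow> bool" where
  "lambert_quadrilateral a b c d \<longleftrightarrow>
     hyp_quadrilateral a b c d \<and>
     (\<exists>\<phi>. 0 \<le> \<phi> \<and> \<phi> < pi / 2 \<and> mset (quad_angles a b c d) = {#pi / 2, pi / 2, pi / 2, \<phi>#})"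

end

theory Submission
  imports Defs
begin

text \<open>
  Let \<open>Q\<close> be the form with \<open>cosh (rho(x,y)) = Q(x,y) / ((1 - |x|^2) (1 - |y|^2))\<close>, and let
  \<open>T(a,z) = (z - a) (1 - a cnj z)\<close>, a positive multiple of the image of \<open>z\<close> under the Moebius
  transformation taking \<open>a\<close> to \<open>0\<close>.  The vector \<open>t(z) = 2 T(a,z) / Q(a,z)\<close> is the position of \<open>z\<close>
  in the Klein model centred at \<open>a\<close>, and
  \<open>Q(a,a) Q(u,w) = Q(a,u) Q(a,w) (1 - t(u) \<bullet> t(w))\<close>; in particular \<open>|t(z)| = tanh (rho(a,z))\<close>.

  The angle conditions at \<open>a\<close>, \<open>b\<close>, \<open>d\<close> become \<open>t(b) \<bullet> t(d) = 0\<close>, \<open>t(b) \<bullet> t(c) = |t(b)|^2\<close> and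
  \<open>t(d) \<bullet> t(c) = |t(d)|^2\<close>.  So \<open>0, t(b), t(c), t(d)\<close> is a Euclidean rectangle, and Pythagoras
  gives \<open>tanh^2 (rho(a,b)) + tanh^2 (rho(a,d)) = |t(c)|^2\<close>, which is \<open>1\<close> if \<open>c\<close> is ideal.  Since a
  common perpendicular realizes the distance, \<open>d\<^sub>1 = rho(a,b)\<close> and \<open>d\<^sub>2 = rho(a,d)\<close>.
\<close>

text \<open>The map from the Poincare disk to the Klein disk, which turns geodesics into chords.\<close>

definition klein :: "complex \<Rightarrow> complex" where
  "klein z = (2 / (1 + (cmod z)\<^sup>2)) *\<^sub>R z"

section \<open>The invariant form and Klein coordinates centred at a point\<close>

text \<open>The form \<open>Q\<close> above: up to sign the Minkowski product of the lifts of
  \<open>x\<close> and \<open>y\<close> to the hyperboloid, with denominators cleared so that ideal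
  points are allowed.\<close>

definition lorentz :: "complex \<Rightarrow> complex \<Rightarrow> real" where
  "lorentz x y = (1 - (cmod x)\<^sup>2) * (1 - (cmod y)\<^sup>2) + 2 * (cmod (x - y))\<^sup>2"

text \<open>This is \<open>T\<close> above. For \<open>v\<close> inside the disk, the Moebius map
  sending \<open>v\<close> to 0 has positive derivative there, so this is the initial direction of
  the geodesic from \<open>v\<close> to \<open>z\<close>.\<close>

definition geo_dir :: "complex \<Rightarrow> complex \<Rightarrow> complex" where
  "geo_dir v z = (z - v) * (1 - v * cnj z)"

definition klein_at :: "complex \<Rightarrow> complex \<Rightarrow> complex" where
  "klein_at a z = (2 / lorentz a z) *\<^sub>R geo_dir a z"

lemma one_plus_sq_pos: "0 < 1 + (x::real)\<^sup>2"
  by (simp add: add_pos_nonneg)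

lemma mult_less_one:
  fixes x y :: real
  assumes "0 \<le> x" "x < 1" "0 \<le> y" "y < 1"
  shows "x * y < 1"
  using mult_strict_mono'[of x 1 y 1] assms by simp

lemma lorentz_sym: "lorentz x y = lorentz y x"
  by (simp add: lorentz_def norm_minus_commute mult.commute)

lemma lorentz_self: "lorentz x x = (1 - (cmod x)\<^sup>2)\<^sup>2"
  by (simp add: lorentz_def power2_eq_square)

lemma lorentz_pos:
  assumes "x \<in> ball 0 1" "y \<in> cball 0 1"
  shows "0 < lorentz x y"
proof (cases "x = y")
  case True
  then show ?thesis
    using assms by (auto simp: lorentz_self abs_square_eq_1)
next
  case False
  moreover have "0 \<le> (1 - (cmod x)\<^sup>2) * (1 - (cmod y)\<^sup>2)"
    using assms by (simp add: power_le_one)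
  ultimately show ?thesis
    unfolding lorentz_def by (simp add: add_nonneg_pos)
qed

text \<open>Rests on \<open>a\<^sup>2 * cnj u = 2 * (a \<bullet> u) * a - (cmod a)\<^sup>2 *
  u\<close>; a real combination of \<open>u\<close> and \<open>a\<close> lets inner products expand
  bilinearly.\<close>

lemma geo_dir_eq:
  "geo_dir a u = (1 - (cmod a)\<^sup>2) *\<^sub>R u - (1 + (cmod u)\<^sup>2 - 2 * (a \<bullet> u)) *\<^sub>R a"
  unfolding geo_dir_def cmod_power2 inner_complex_def complex_eq_iff
  by (simp add: algebra_simps power2_eq_square)

lemma lorentz_eq: "lorentz x y = (1 + (cmod x)\<^sup>2) * (1 + (cmod y)\<^sup>2) - 4 * (x \<bullet> y)"
  unfolding lorentz_def power2_norm_eq_inner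
  by (simp add: inner_diff_left inner_diff_right inner_commute algebra_simps)

text \<open>The hyperbolic law of cosines at \<open>a\<close> with denominators cleared; the inner
  product carries the term sinh sinh cos.\<close>

lemma lorentz_geo_dir:
  "lorentz a a * lorentz u w = lorentz a u * lorentz a w - 4 * (geo_dir a u \<bullet> geo_dir a w)"
proof -
  have "geo_dir a u \<bullet> geo_dir a w =
    (1 - a \<bullet> a)\<^sup>2 * (u \<bullet> w) - (1 - a \<bullet> a) * (1 + w \<bullet> w - 2 * (a \<bullet> w)) * (a \<bullet> u)
    - (1 - a \<bullet> a) * (1 + u \<bullet> u - 2 * (a \<bullet> u)) * (a \<bullet> w)
    + (1 + u \<bullet> u - 2 * (a \<bullet> u)) * (1 + w \<bullet> w - 2 * (a \<bullet> w)) * (a \<bullet> a)"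
    unfolding geo_dir_eq inner_diff_left inner_diff_right inner_scaleR_left inner_scaleR_right
      power2_norm_eq_inner inner_commute[of u a] by algebra
  then show ?thesis
    unfolding lorentz_eq power2_norm_eq_inner by (simp add: algebra_simps power2_eq_square)
qed

lemma lorentz_klein_at:
  assumes "lorentz a u \<noteq> 0" "lorentz a w \<noteq> 0"
  shows "lorentz a a * lorentz u w =
    lorentz a u * lorentz a w * (1 - klein_at a u \<bullet> klein_at a w)"
  unfolding lorentz_geo_dir using assms by (simp add: klein_at_def field_simps)

lemma klein_at_eq_0_iff:
  assumes "a \<in> ball 0 1" "z \<in> cball 0 1"
  shows "klein_at a z = 0 \<longleftrightarrow> z = a"
proof -
  have "cmod a * cmod z < 1"
    using assms by (cases "z = 0") (auto intro: order.strict_trans2[OF mult_strict_right_mono])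
  then have "1 - a * cnj z \<noteq> 0"
    by (metis complex_mod_cnj diff_eq_diff_eq diff_zero less_irrefl norm_mult norm_one right_minus_eq)
  then show ?thesis
    using lorentz_pos[OF assms] by (simp add: klein_at_def geo_dir_def)
qed

text \<open>The right angle at \<open>b\<close> gives hyperbolic Pythagoras, cosh rho(a,y) = cosh
  rho(a,b) cosh rho(b,y). Written in Klein coordinates at \<open>a\<close>, it cancels to a linear
  condition; in cleared form it also covers ideal \<open>y\<close>.\<close>

lemma klein_at_perp_at_end:
  assumes a: "a \<in> ball 0 1" and b: "b \<in> ball 0 1" and y: "y \<in> cball 0 1"
    and perp: "geo_dir b y \<bullet> geo_dir b a = 0"
  shows "klein_at a b \<bullet> klein_at a y = (cmod (klein_at a b))\<^sup>2"
proof -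
  have pos: "0 < lorentz a a" "0 < lorentz a b" "0 < lorentz a y"
    using lorentz_pos a b y by auto
  let ?A = "lorentz a a" and ?B = "lorentz a b" and ?Y = "lorentz a y"
  let ?s = "klein_at a b \<bullet> klein_at a b" and ?p = "klein_at a b \<bullet> klein_at a y"
  have "lorentz b b * ?Y = lorentz b y * ?B"
    using lorentz_geo_dir[of b y a] perp by (simp add: lorentz_sym)
  then have "(?A * lorentz b b) * ?Y = (?A * lorentz b y) * ?B"
    by (simp add: mult.assoc)
  then have "(?B * ?B * (1 - ?s)) * ?Y = (?B * ?Y * (1 - ?p)) * ?B"
    using lorentz_klein_at[of a b b] lorentz_klein_at[of a b y] pos by simp
  then have "?s = ?p"
    using pos by simp
  then show ?thesis
    by (simp add: power2_norm_eq_inner)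
qed

text \<open>
  With \<open>w = y - b\<close>, Cauchy-Schwarz bounds \<open>x \<bullet> y = x \<bullet> w\<close>, and the claim reduces to
  \<open>0 \<le> P (|x| - |w|)^2 + (1 - P) |w|^2 (1 - |x|^2)\<close> for \<open>P = 1 - |b|^2\<close>.
\<close>

lemma klein_form_le:
  fixes x y b :: "'a::real_inner"
  assumes "x \<bullet> b = 0" "b \<bullet> y = (norm b)\<^sup>2" "norm x < 1" "norm y < 1" "norm b < 1"
  shows "(1 - (norm x)\<^sup>2) * (1 - (norm y)\<^sup>2) \<le> (1 - (norm b)\<^sup>2) * (1 - x \<bullet> y)\<^sup>2"
proof -
  define w where "w = y - b"
  define X where "X = norm x"
  define e where "e = norm w"
  define P where "P = 1 - (norm b)\<^sup>2"
  have bw: "b \<bullet> w = 0"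
    using assms by (simp add: w_def inner_diff_right power2_norm_eq_inner)
  have ny: "(norm y)\<^sup>2 = (norm b)\<^sup>2 + e\<^sup>2"
    using bw unfolding e_def w_def power2_norm_eq_inner
    by (simp add: inner_diff_left inner_diff_right inner_commute)
  have "(norm y)\<^sup>2 < 1" using assms by (simp add: abs_square_less_1)
  then have "e\<^sup>2 < 1" unfolding ny by (smt (verit) zero_le_power2)
  then have e: "0 \<le> e" "e < 1" by (simp_all add: e_def abs_square_less_1)
  have X: "0 \<le> X" "X < 1" using assms by (auto simp: X_def)
  have P: "0 \<le> P" "P \<le> 1" using assms by (simp_all add: P_def power_le_one)
  have "x \<bullet> y = x \<bullet> w"
    using assms by (simp add: w_def inner_diff_right)
  also have "\<dots> \<le> X * e"
    unfolding X_def e_def by (rule norm_cauchy_schwarz)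
  finally have xy: "x \<bullet> y \<le> X * e" .
  have "X * e \<le> 1" using X e by (simp add: mult_le_one)
  with xy have "(1 - X * e)\<^sup>2 \<le> (1 - x \<bullet> y)\<^sup>2"
    by (intro power_mono) auto
  then have *: "P * (1 - X * e)\<^sup>2 \<le> P * (1 - x \<bullet> y)\<^sup>2"
    using P by (rule_tac mult_left_mono) auto
  have "0 \<le> P * (X - e)\<^sup>2 + (1 - P) * (e\<^sup>2 * (1 - X\<^sup>2))"
    using P X by (intro add_nonneg_nonneg mult_nonneg_nonneg) (auto simp: power_le_one)
  also have "\<dots> = P * (1 - X * e)\<^sup>2 - (1 - X\<^sup>2) * (P - e\<^sup>2)"
    by algebra
  finally show ?thesis
    using * ny unfolding X_def P_def by (simp add: algebra_simps)
qed

section \<open>Distances through the form, and common perpendiculars\<close>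

text \<open>With \<open>u\<close> the quotient inside \<open>artanh\<close>, tanh rho = 2u / (1 +
  u^2). The result is tanh^2 = 1 - 1 / cosh^2.\<close>

lemma
  assumes "x \<in> ball 0 1" "y \<in> ball 0 1"
  shows hyp_dist_nonneg: "0 \<le> hyp_dist x y"
    and tanh_hyp_dist: "(tanh (hyp_dist x y))\<^sup>2 = 1 - lorentz x x * lorentz y y / (lorentz x y)\<^sup>2"
proof -
  define d where "d = cmod (x - y)"
  define E where "E = (1 - (cmod x)\<^sup>2) * (1 - (cmod y)\<^sup>2)"
  define r where "r = sqrt (d\<^sup>2 + E)"
  define u where "u = d / r"
  have E: "0 < E" using assms by (simp add: E_def abs_square_less_1)
  have d: "0 \<le> d" by (simp add: d_def)
  have r: "r\<^sup>2 = d\<^sup>2 + E" "0 < r" using E by (simp_all add: r_def add_nonneg_pos)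
  have "d < r" using E d unfolding r_def by (simp add: real_less_rsqrt)
  then have u: "0 \<le> u" "u < 1" using d r by (simp_all add: u_def)
  have h: "hyp_dist x y = 2 * artanh u"
    by (simp add: hyp_dist_def u_def r_def d_def E_def)
  have "0 \<le> artanh u" using u by (simp add: artanh_def)
  then show "0 \<le> hyp_dist x y" by (simp add: h)
  have "1 \<le> (1 + u) / (1 - u)" using u by simp
  then have "exp (2 * (2 * artanh u)) = exp (2 * ln ((1 + u) / (1 - u)))"
    by (simp add: artanh_def)
  also have "\<dots> = ((1 + u) / (1 - u))\<^sup>2"
    using u by (simp only: exp_double exp_ln divide_pos_pos)
  finally have ex: "exp (2 * (2 * artanh u)) = ((1 + u) / (1 - u))\<^sup>2" .
  have t: "tanh z = (exp (2 * z) - 1) / (exp (2 * z) + 1)" for z :: real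
  proof -
    have "exp z - exp (- z) = (exp (2 * z) - 1) / exp z" "exp z + exp (- z) = (exp (2 * z) + 1) / exp z"
      by (simp_all add: exp_minus exp_double power2_eq_square divide_simps)
    then show ?thesis by (simp add: tanh_altdef)
  qed
  have "tanh (hyp_dist x y) = (((1 + u) / (1 - u))\<^sup>2 - 1) / (((1 + u) / (1 - u))\<^sup>2 + 1)"
    unfolding h t ex ..
  also have "\<dots> = 2 * u / (1 + u\<^sup>2)"
    using u one_plus_sq_pos[of u] by (simp add: divide_simps) algebra
  finally have "(tanh (hyp_dist x y))\<^sup>2 = 4 * u\<^sup>2 / (1 + u\<^sup>2)\<^sup>2"
    by (simp add: power_divide power_mult_distrib)
  also have "u\<^sup>2 = d\<^sup>2 / (d\<^sup>2 + E)"
    by (simp add: u_def power_divide r(1))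
  also have "1 + d\<^sup>2 / (d\<^sup>2 + E) = (E + 2 * d\<^sup>2) / (d\<^sup>2 + E)"
  proof -
    have "d\<^sup>2 + E \<noteq> 0" using r by (metis less_irrefl power_not_zero)
    then show ?thesis by (simp add: divide_simps)
  qed
  also have "4 * (d\<^sup>2 / (d\<^sup>2 + E)) / ((E + 2 * d\<^sup>2) / (d\<^sup>2 + E))\<^sup>2
    = 4 * d\<^sup>2 * (d\<^sup>2 + E) / (E + 2 * d\<^sup>2)\<^sup>2"
    by (simp add: power2_eq_square)
  also have "4 * d\<^sup>2 * (d\<^sup>2 + E) = (E + 2 * d\<^sup>2)\<^sup>2 - E\<^sup>2"
    by (simp add: power2_eq_square algebra_simps)
  also have "((E + 2 * d\<^sup>2)\<^sup>2 - E\<^sup>2) / (E + 2 * d\<^sup>2)\<^sup>2 = 1 - E\<^sup>2 / (E + 2 * d\<^sup>2)\<^sup>2"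
  proof -
    have "0 < E + 2 * d\<^sup>2" using E by (simp add: add_pos_nonneg)
    then show ?thesis by (simp add: diff_divide_distrib)
  qed
  also have "E\<^sup>2 = lorentz x x * lorentz y y"
    by (simp add: E_def lorentz_self power_mult_distrib)
  also have "E + 2 * d\<^sup>2 = lorentz x y" by (simp add: E_def d_def lorentz_def)
  finally show "(tanh (hyp_dist x y))\<^sup>2 = 1 - lorentz x x * lorentz y y / (lorentz x y)\<^sup>2" .
qed

text \<open>The right side matches \<open>tanh_hyp_dist\<close>. On the unit circle
  \<open>lorentz z z = 0\<close>, so an ideal \<open>z\<close> has Klein norm 1.\<close>

lemma klein_at_norm:
  assumes "a \<in> ball 0 1" "z \<in> cball 0 1"
  shows "(cmod (klein_at a z))\<^sup>2 = 1 - lorentz a a * lorentz z z / (lorentz a z)\<^sup>2"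
  using lorentz_klein_at[of a z z] lorentz_pos[OF assms]
  unfolding power2_norm_eq_inner by (simp add: field_simps power2_eq_square)

lemma klein_at_norm_less_1:
  assumes "a \<in> ball 0 1" "z \<in> ball 0 1"
  shows "cmod (klein_at a z) < 1"
proof -
  have "(cmod (klein_at a z))\<^sup>2 < 1"
    using klein_at_norm[of a z] assms lorentz_pos[of a z] lorentz_pos[of a a] lorentz_pos[of z z]
    by simp
  then show ?thesis by (simp add: abs_square_less_1)
qed

text \<open>In Klein coordinates at \<open>a\<close>, \<open>t(x)\<close> and
  \<open>t(y) - t(b)\<close> are both orthogonal to \<open>t(b)\<close>. Then
  \<open>klein_form_le\<close> says 1 / cosh^2 rho(x,y) \<le> 1 / cosh^2 rho(a,b), so the infimum is
  attained at \<open>a\<close>, \<open>b\<close>.\<close>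

lemma hyp_setdist_common_perpendicular:
  assumes "a \<in> ball 0 1" "b \<in> ball 0 1" "a \<in> A" "b \<in> B" "A \<subseteq> ball 0 1" "B \<subseteq> ball 0 1"
    and A: "\<And>x. x \<in> A \<Longrightarrow> geo_dir a x \<bullet> geo_dir a b = 0"
    and B: "\<And>y. y \<in> B \<Longrightarrow> geo_dir b y \<bullet> geo_dir b a = 0"
  shows "hyp_setdist A B = hyp_dist a b"
proof -
  have "hyp_dist a b \<le> hyp_dist x y" if xA: "x \<in> A" and yB: "y \<in> B" for x y
  proof -
    have xy: "x \<in> ball 0 1" "y \<in> ball 0 1" using assms that by auto
    have pos: "0 < lorentz a a" "0 < lorentz a b" "0 < lorentz a x" "0 < lorentz a y"
      "0 < lorentz x y"
      using lorentz_pos assms xy by auto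
    define tx ty tb where t: "tx = klein_at a x" "ty = klein_at a y" "tb = klein_at a b"
    have "tx \<bullet> tb = 0" using A[OF xA] by (simp add: t klein_at_def)
    moreover have "tb \<bullet> ty = (cmod tb)\<^sup>2"
      unfolding t using klein_at_perp_at_end[of a b y] B[OF yB] assms xy by auto
    ultimately have le: "(1 - tx \<bullet> tx) * (1 - ty \<bullet> ty) \<le> (1 - tb \<bullet> tb) * (1 - tx \<bullet> ty)\<^sup>2"
      using klein_form_le[of tx tb ty] klein_at_norm_less_1 assms xy
      by (simp add: t power2_norm_eq_inner)
    let ?A = "lorentz a a" and ?B = "lorentz a b" and ?X = "lorentz a x" and ?Y = "lorentz a y"
    have xx: "?A * lorentz x x = ?X * ?X * (1 - tx \<bullet> tx)" 
      and yy: "?A * lorentz y y = ?Y * ?Y * (1 - ty \<bullet> ty)" 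
      and bb: "?A * lorentz b b = ?B * ?B * (1 - tb \<bullet> tb)" 
      and xy': "?A * lorentz x y = ?X * ?Y * (1 - tx \<bullet> ty)" 
      using pos by (auto simp: t intro: lorentz_klein_at)
    \<comment> \<open>The factor \<open>?A\<^sup>2\<close> lets every value of the form be replaced
      by its Klein expression at \<open>a\<close>; it is cancelled afterwards.\<close>
    have "?A\<^sup>2 * (lorentz x x * lorentz y y * ?B\<^sup>2) = (?X * ?Y * ?B)\<^sup>2 * ((1 - tx \<bullet> tx) * (1 - ty \<bullet> ty))"
      using xx yy by algebra
    also have "\<dots> \<le> (?X * ?Y * ?B)\<^sup>2 * ((1 - tb \<bullet> tb) * (1 - tx \<bullet> ty)\<^sup>2)"
      using le by (rule mult_left_mono) simp
    also have "\<dots> = ?A\<^sup>2 * (?A * lorentz b b * (lorentz x y)\<^sup>2)"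
      using bb xy' by algebra
    finally have "lorentz x x * lorentz y y * ?B\<^sup>2 \<le> ?A * lorentz b b * (lorentz x y)\<^sup>2"
      using pos by simp
    then have "(tanh (hyp_dist a b))\<^sup>2 \<le> (tanh (hyp_dist x y))\<^sup>2"
      using assms xy pos by (simp add: tanh_hyp_dist field_simps)
    moreover have "0 \<le> hyp_dist a b" "0 \<le> hyp_dist x y"
      using hyp_dist_nonneg assms xy by auto
    ultimately have "tanh (hyp_dist a b) \<le> tanh (hyp_dist x y)"
      by (metis power2_le_imp_le tanh_real_nonneg_iff)
    then show ?thesis by simp
  qed
  then show ?thesis
    unfolding hyp_setdist_def using assms(3,4)
    by (intro cInf_eq_minimum) auto
qed

section \<open>Geodesics as chords of the Klein disk\<close>

text \<open>Expansion gives \<open>z + v\<^sup>2 * cnj z - (1 + (cmod z)\<^sup>2) * v\<close>, which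
  up to a positive factor is real-affine in \<open>klein z\<close>.\<close>

lemma geo_dir_klein:
  "geo_dir v z = ((1 + (cmod z)\<^sup>2) / 2) *\<^sub>R (klein z + v\<^sup>2 * cnj (klein z) - 2 * v)"
proof -
  have "2 + 2 * (cmod z)\<^sup>2 \<noteq> 0" using one_plus_sq_pos[of "cmod z"] by linarith
  then have "((1 + (cmod z)\<^sup>2) / 2) *\<^sub>R klein z = z"
    "((1 + (cmod z)\<^sup>2) / 2) *\<^sub>R cnj (klein z) = cnj z"
    by (simp_all add: klein_def mult.commute)
  then have "((1 + (cmod z)\<^sup>2) / 2) *\<^sub>R (klein z + v\<^sup>2 * cnj (klein z) - 2 * v)
    = z + v\<^sup>2 * cnj z - of_real ((1 + (cmod z)\<^sup>2) / 2) * (2 * v)"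
    by (simp only: scaleR_diff_right scaleR_add_right mult_scaleR_right[symmetric])
      (simp only: scaleR_conv_of_real mult.left_commute)
  also have "of_real ((1 + (cmod z)\<^sup>2) / 2) * (2 * v) = (1 + z * cnj z) * v"
    by (simp flip: complex_norm_square)
  finally show ?thesis
    by (simp add: geo_dir_def algebra_simps power2_eq_square)
qed

text \<open>The affine factor vanishes at \<open>klein v\<close>, hence only scales along a chord
  issuing from there.\<close>

lemma geo_dir_chord:
  assumes "klein z = klein v + s *\<^sub>R (klein w - klein v)"
  shows "geo_dir v z = (s * (1 + (cmod z)\<^sup>2) / (1 + (cmod w)\<^sup>2)) *\<^sub>R geo_dir v w"
proof -
  define F where "F p = p + v\<^sup>2 * cnj p - 2 * v" for p
  have "geo_dir v v = 0" by (simp add: geo_dir_def)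
  then have "F (klein v) = 0"
    unfolding geo_dir_klein F_def using one_plus_sq_pos[of "cmod v"] by auto
  moreover have "F (p + s *\<^sub>R (q - p)) = F p + s *\<^sub>R (F q - F p)" for p q
    by (simp add: F_def scaleR_conv_of_real algebra_simps)
  ultimately have "F (klein z) = s *\<^sub>R F (klein w)"
    by (simp add: assms)
  then show ?thesis
    unfolding geo_dir_klein using one_plus_sq_pos[of "cmod w"] by (simp flip: F_def)
qed

lemma klein_norm: "1 - (cmod (klein z))\<^sup>2 = ((1 - (cmod z)\<^sup>2) / (1 + (cmod z)\<^sup>2))\<^sup>2"
proof -
  have "(cmod (klein z))\<^sup>2 = (2 / (1 + (cmod z)\<^sup>2))\<^sup>2 * (cmod z)\<^sup>2"
    by (simp add: klein_def power_mult_distrib power_divide)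
  then show ?thesis
    using one_plus_sq_pos[of "cmod z"] by (simp add: divide_simps) algebra
qed

lemma klein_norm_le_1: "cmod (klein z) \<le> 1"
proof -
  have "0 \<le> 1 - (cmod (klein z))\<^sup>2" by (simp add: klein_norm)
  then show ?thesis by (simp add: abs_square_le_1)
qed

text \<open>On the closed disk \<open>klein_norm\<close> determines \<open>cmod z\<close>, and then
  \<open>z\<close> is a known multiple of \<open>klein z\<close>.\<close>

lemma inj_on_klein: "inj_on klein (cball 0 1)"
proof (rule inj_onI)
  fix z w :: complex
  assume zw: "z \<in> cball 0 1" "w \<in> cball 0 1" and eq: "klein z = klein w"
  define r s where "r = (cmod z)\<^sup>2" and "s = (cmod w)\<^sup>2"
  have rs: "0 \<le> r" "r \<le> 1" "0 \<le> s" "s \<le> 1"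
    using zw by (auto simp: r_def s_def power_le_one)
  have "((1 - r) / (1 + r))\<^sup>2 = ((1 - s) / (1 + s))\<^sup>2"
    using eq unfolding r_def s_def klein_norm[symmetric] by simp
  then have "(1 - r) / (1 + r) = (1 - s) / (1 + s)"
    using rs by (simp add: power2_eq_iff_nonneg)
  then have "r = s" using rs by (simp add: field_simps)
  then show "z = w"
    using eq one_plus_sq_pos[of "cmod w"] by (simp add: klein_def r_def s_def)
qed

lemma continuous_on_klein: "continuous_on S klein"
proof -
  have "1 + (cmod z)\<^sup>2 \<noteq> 0" for z using one_plus_sq_pos[of "cmod z"] by simp
  then show ?thesis
    unfolding klein_def by (intro continuous_intros) auto
qed

text \<open>A circle centred at \<open>p\<close> and perpendicular to the unit circle has equation 2
  (p \<bullet> z) = 1 + |z|^2, which is linear in \<open>klein z\<close>. The closure brings in the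
  ideal end points.\<close>

lemma hyp_line_klein:
  assumes "hyp_line l"
  obtains \<beta> \<alpha> where "\<beta> \<noteq> 0" "\<And>z. z \<in> closure l \<Longrightarrow> cmod z \<le> 1 \<and> \<beta> \<bullet> klein z = \<alpha>"
proof -
  obtain C where C: "perp_unit_circle C \<or> (\<exists>u. u \<noteq> 0 \<and> C = span {u})" and l: "l = C \<inter> ball 0 1"
    using assms by (auto simp: hyp_line_def)
  have "closed C"
    using C by (auto simp: perp_unit_circle_def closed_span)
  then have "closure l \<subseteq> C \<inter> cball 0 1"
    unfolding l by (intro closure_minimal) auto
  then have cl: "z \<in> C" "cmod z \<le> 1" if "z \<in> closure l" for z
    using that by auto
  consider p r where "C = sphere p r" "C \<inter> sphere 0 1 \<noteq> {}"
      "\<forall>z \<in> C \<inter> sphere 0 1. orthogonal (z - p) z"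
    | u where "u \<noteq> 0" "C = span {u}"
    using C by (auto simp: perp_unit_circle_def)
  then show thesis
  proof cases
    case 1
    then obtain x where "x \<in> C \<inter> sphere 0 1" by blast
    with 1 have x: "x \<in> sphere p r" "cmod x = 1" "(x - p) \<bullet> x = 0"
      by (auto simp: orthogonal_def)
    have px: "p \<bullet> x = 1"
      using x by (simp add: inner_diff_left flip: power2_norm_eq_inner)
    have sq: "r\<^sup>2 = z \<bullet> z - 2 * (p \<bullet> z) + p \<bullet> p" if "z \<in> sphere p r" for z
    proof -
      have "r\<^sup>2 = (z - p) \<bullet> (z - p)"
        using that by (auto simp: dist_norm norm_minus_commute simp flip: power2_norm_eq_inner)
      then show ?thesis by (simp add: inner_diff_left inner_diff_right inner_commute)
    qed
    have "p \<bullet> klein z = 1" if "z \<in> closure l" for z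
    proof -
      have "x \<bullet> x = 1" using x by (simp flip: power2_norm_eq_inner)
      \<comment> \<open>Subtracts the circle equation at the common point \<open>x\<close>, where
        \<open>x \<bullet> x = p \<bullet> x = 1\<close>, from the one at \<open>z\<close>.\<close>
      then have "2 * (p \<bullet> z) = 1 + (cmod z)\<^sup>2"
        using sq[of z] sq[of x] cl[OF that] 1 x px by (simp add: power2_norm_eq_inner)
      then show ?thesis
        using one_plus_sq_pos[of "cmod z"] by (simp add: klein_def)
    qed
    moreover have "p \<noteq> 0" using px by auto
    ultimately show thesis using that[of p 1] cl by auto
  next
    case 2
    have "(\<i> * u) \<bullet> klein z = 0" if "z \<in> closure l" for z
      using cl[OF that] 2 by (auto simp: span_singleton klein_def inner_complex_def)
    then show thesis using that[of "\<i> * u" 0] cl 2 by auto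
  qed
qed

lemma complex_eq_of_inner:
  fixes x y \<beta> :: complex
  assumes "\<beta> \<noteq> 0" "\<beta> \<bullet> x = \<beta> \<bullet> y" "(\<i> * \<beta>) \<bullet> x = (\<i> * \<beta>) \<bullet> y"
  shows "x = y"
proof -
  have "cnj \<beta> * x = cnj \<beta> * y"
    using assms(2,3) by (simp add: complex_eq_iff inner_complex_def algebra_simps)
  then show ?thesis using assms(1) by simp
qed

text \<open>A continuous injective path on a line is monotone, so it stays strictly between its
  ends; strict convexity of the disk keeps it off the unit circle.\<close>

lemma hyp_arc_klein:
  assumes arc: "hyp_arc v w g" and t: "0 < t" "t < 1"
  obtains s where "0 < s" "s < 1" "klein (g t) = klein v + s *\<^sub>R (klein w - klein v)"
    "cmod (g t) < 1"
proof -
  obtain l where g: "arc g" "g 0 = v" "g 1 = w" and l: "hyp_line l" "path_image g \<subseteq> closure l"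
    using arc by (auto simp: hyp_arc_def pathstart_def pathfinish_def)
  obtain \<beta> \<alpha> where \<beta>: "\<beta> \<noteq> 0" "\<And>z. z \<in> closure l \<Longrightarrow> cmod z \<le> 1 \<and> \<beta> \<bullet> klein z = \<alpha>"
    using hyp_line_klein[OF l(1)] by blast
  have gt: "cmod (g t) \<le> 1" "\<beta> \<bullet> klein (g t) = \<alpha>" if "t \<in> {0..1}" for t
    using \<beta>(2)[OF subsetD[OF l(2)], of "g t"] that by (auto simp: path_image_def)
  \<comment> \<open>The coordinate along the chord: \<open>\<beta>\<close> is normal to it and
    \<open>\<i> * \<beta>\<close> parallel.\<close>
  define h where "h t = (\<i> * \<beta>) \<bullet> klein (g t)" for t
  have "continuous_on {0..1} g" using g(1) by (simp add: arc_def path_def)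
  then have "continuous_on {0..1} h"
    unfolding h_def
    by (intro continuous_intros continuous_on_compose2[OF continuous_on_klein]) auto
  moreover have "inj_on h {0..1}"
  proof (rule inj_onI)
    fix r s :: real
    assume rs: "r \<in> {0..1}" "s \<in> {0..1}" "h r = h s"
    then have "klein (g r) = klein (g s)"
      using \<beta>(1) gt by (intro complex_eq_of_inner[of \<beta>]) (auto simp: h_def)
    then have "g r = g s"
      using gt rs by (rule_tac inj_onD[OF inj_on_klein]) auto
    then show "r = s" using g(1) rs by (auto simp: arc_def dest: inj_onD)
  qed
  ultimately have mono: "(h 0 < h t \<and> h t < h 1) \<or> (h 1 < h t \<and> h t < h 0)"
    using t by (intro continuous_inj_imp_mono)
  define s where "s = (h t - h 0) / (h 1 - h 0)"
  have s: "0 < s" "s < 1"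
    using mono by (auto simp: s_def divide_simps)
  have "s * (h 1 - h 0) = h t - h 0" using mono by (auto simp: s_def)
  then have eq: "klein (g t) = klein v + s *\<^sub>R (klein w - klein v)"
    using \<beta>(1) gt[of t] gt[of 0] gt[of 1] t g
    by (intro complex_eq_of_inner[of \<beta>])
      (auto simp: h_def inner_add_right inner_diff_right)
  \<comment> \<open>Distinct ends make the last term of the next identity strictly negative: this is
    the strict convexity.\<close>
  have "klein v \<noteq> klein w" using mono g by (auto simp: h_def)
  moreover have "(cmod (klein (g t)))\<^sup>2 = (1 - s) * (cmod (klein v))\<^sup>2 + s * (cmod (klein w))\<^sup>2
      - s * (1 - s) * (cmod (klein w - klein v))\<^sup>2"
    unfolding eq power2_norm_eq_inner
    by (simp add: inner_add_left inner_add_right inner_diff_left inner_diff_right inner_commute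
        algebra_simps power2_eq_square)
  moreover have "(1 - s) * (cmod (klein v))\<^sup>2 \<le> 1 - s" "s * (cmod (klein w))\<^sup>2 \<le> s"
    using s klein_norm_le_1 by (auto simp: mult_left_le power_le_one)
  moreover have "0 < s * (1 - s) * (cmod (klein w - klein v))\<^sup>2"
    using s calculation(1) by simp
  ultimately have "0 < 1 - (cmod (klein (g t)))\<^sup>2" by linarith
  then have "cmod (g t) \<noteq> 1" unfolding klein_norm by auto
  with gt[of t] t have "cmod (g t) < 1" by auto
  with s eq show thesis using that by blast
qed

section \<open>Segments and their tangent directions\<close>

lemma hyp_arc_sym: "hyp_arc v w g \<Longrightarrow> hyp_arc w v (reversepath g)"
  by (auto simp: hyp_arc_def arc_reversepath)

lemma hyp_seg_sym: "hyp_seg v w = hyp_seg w v"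
proof -
  have "hyp_seg v w \<subseteq> hyp_seg w v" for v w
    unfolding hyp_seg_def by (auto intro!: exI[of _ "reversepath _"] hyp_arc_sym)
  then show ?thesis by blast
qed

lemma hyp_seg_start:
  assumes "hyp_arc v w g" "cmod v < 1"
  shows "v \<in> hyp_seg v w"
  using assms by (auto simp: hyp_seg_def hyp_arc_def)

lemma hyp_arc_neq: "hyp_arc v w g \<Longrightarrow> v \<noteq> w"
  unfolding hyp_arc_def by (metis arc_distinct_ends)

lemma hyp_seg_klein:
  assumes "z \<in> hyp_seg v w"
  obtains s where "0 \<le> s" "s \<le> 1" "klein z = klein v + s *\<^sub>R (klein w - klein v)"
proof -
  obtain g t where g: "hyp_arc v w g" and z: "z = g t" and t: "0 \<le> t" "t \<le> 1"
    using assms by (auto simp: hyp_seg_def path_image_def)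
  have gs: "g 0 = v" "g 1 = w" using g by (auto simp: hyp_arc_def pathstart_def pathfinish_def)
  consider "t = 0" | "t = 1" | "0 < t" "t < 1" using t by linarith
  then show thesis
  proof cases
    case 1 then show thesis using that[of 0] z gs by simp
  next
    case 2 then show thesis using that[of 1] z gs by simp
  next
    case 3 then show thesis using hyp_arc_klein[OF g 3] that z by (metis less_imp_le)
  qed
qed

lemma geo_dir_hyp_seg:
  assumes "z \<in> hyp_seg v w"
  obtains k where "0 \<le> k" "geo_dir v z = k *\<^sub>R geo_dir v w"
proof -
  obtain s where s: "0 \<le> s" "klein z = klein v + s *\<^sub>R (klein w - klein v)"
    using hyp_seg_klein[OF assms] by blast
  show thesis
    by (rule that[OF _ geo_dir_chord[OF s(2)]]) (use s in auto)
qed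

text \<open>Makes the filter in \<open>hyp_dir\<close> nontrivial, so that \<open>Lim\<close> picks
  the actual limit.\<close>

lemma islimpt_hyp_seg:
  assumes g: "hyp_arc v w g"
  shows "v islimpt hyp_seg v w"
  unfolding islimpt_approachable
proof (intro allI impI)
  fix e :: real
  assume e: "0 < e"
  have gs: "g 0 = v" "inj_on g {0..1}" "continuous_on {0..1} g"
    using g by (auto simp: hyp_arc_def pathstart_def arc_def path_def)
  then obtain d where d: "0 < d" "\<And>t. t \<in> {0..1} \<Longrightarrow> dist t 0 < d \<Longrightarrow> dist (g t) (g 0) < e"
    using e unfolding continuous_on_iff by (metis atLeastAtMost_iff order.refl zero_le_one)
  define t where "t = min (1/2) (d/2)"
  have t: "0 < t" "t < 1" "t < d" using d by (auto simp: t_def)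
  have "cmod (g t) < 1" using hyp_arc_klein[OF g t(1,2)] by blast
  then have "g t \<in> hyp_seg v w"
    using g t by (auto simp: hyp_seg_def path_image_def intro!: exI[of _ g])
  moreover have "g t \<noteq> v" using gs t by (auto dest: inj_onD)
  moreover have "dist (g t) v < e" using d(2)[of t] gs t by auto
  ultimately show "\<exists>x'\<in>hyp_seg v w. x' \<noteq> v \<and> dist x' v < e" by blast
qed

lemma hyp_dir_eq:
  assumes g: "hyp_arc v w g"
    and lim: "((\<lambda>z. sgn (z - v)) \<longlongrightarrow> l) (at v within hyp_seg v w)"
  shows "hyp_dir v w = l"
  unfolding hyp_dir_def using islimpt_hyp_seg[OF g] lim
  by (intro tendsto_Lim) (auto simp: trivial_limit_within)

text \<open>\<open>sgn (z - v)\<close> is the quotient of \<open>sgn (geo_dir v z)\<close>, constant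
  along the segment away from \<open>v\<close>, by \<open>sgn (1 - v * cnj z)\<close>, which tends
  to 1.\<close>

lemma hyp_dir_inside:
  assumes g: "hyp_arc v w g" and v: "cmod v < 1"
  shows "hyp_dir v w = sgn (geo_dir v w)"
proof (rule hyp_dir_eq[OF g])
  let ?F = "at v within hyp_seg v w"
  have "((\<lambda>z. sgn (1 - v * cnj z)) \<longlongrightarrow> sgn (1 - v * cnj v)) ?F"
  proof (intro tendsto_intros)
    have "cmod (v * cnj v) < 1" using v by (simp add: norm_mult abs_square_less_1 flip: power2_eq_square)
    then show "1 - v * cnj v \<noteq> 0" by auto
  qed
  moreover have "1 - v * cnj v = of_real (1 - (cmod v)\<^sup>2)"
    by (simp add: complex_norm_square del: of_real_power)
  moreover have "(cmod v)\<^sup>2 < 1" using v by (simp add: abs_square_less_1)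
  ultimately have "((\<lambda>z. sgn (1 - v * cnj z)) \<longlongrightarrow> 1) ?F"
    by (simp only: sgn_of_real) simp
  then have "((\<lambda>z. sgn (geo_dir v w) / sgn (1 - v * cnj z)) \<longlongrightarrow> sgn (geo_dir v w) / 1) ?F"
    by (intro tendsto_divide tendsto_const) auto
  moreover have "sgn (geo_dir v w) / sgn (1 - v * cnj z) = sgn (z - v)"
    if z: "z \<in> hyp_seg v w" "z \<noteq> v" for z
  proof -
    obtain k where k: "0 \<le> k" "geo_dir v z = k *\<^sub>R geo_dir v w"
      using geo_dir_hyp_seg[OF z(1)] by blast
    have "cmod z < 1" using z by (auto simp: hyp_seg_def)
    then have "cmod (v * cnj z) < 1"
      using v by (simp add: norm_mult mult_less_one)
    then have nz: "1 - v * cnj z \<noteq> 0" by auto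
    then have "k \<noteq> 0" using k z by (auto simp: geo_dir_def)
    then have "sgn (geo_dir v w) = sgn (geo_dir v z)" using k by (simp add: sgn_scaleR)
    also have "\<dots> = sgn (z - v) * sgn (1 - v * cnj z)" by (simp add: geo_dir_def sgn_mult)
    finally show ?thesis using nz by (simp add: sgn_zero_iff)
  qed
  then have "\<forall>\<^sub>F z in ?F. sgn (geo_dir v w) / sgn (1 - v * cnj z) = sgn (z - v)"
    by (auto simp: eventually_at_filter)
  ultimately show "((\<lambda>z. sgn (z - v)) \<longlongrightarrow> sgn (geo_dir v w)) ?F"
    using tendsto_cong by force
qed


text \<open>
  After rotating \<open>v\<close> to \<open>1\<close>, the points \<open>1 + e\<close> of the segment satisfy \<open>Im e = k |e|^2\<close> for a
  constant \<open>k\<close>: the segment is orthogonal to the unit circle.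
\<close>

lemma hyp_dir_boundary:
  assumes g: "hyp_arc v w g" and v: "cmod v = 1" and w: "cmod w \<le> 1"
  shows "hyp_dir v w = - v"
proof (rule hyp_dir_eq[OF g])
  let ?F = "at v within hyp_seg v w"
  have kv: "klein v = v" using v by (simp add: klein_def)
  have vv: "cnj v * v = 1" using v by (metis complex_norm_square mult.commute of_real_1 one_power2)
  define c where "c = cnj v * klein w - 1"
  have "klein w \<noteq> v"
    using inj_onD[OF inj_on_klein, of v w] hyp_arc_neq[OF g] v w kv by auto
  then have c0: "c \<noteq> 0"
    using vv by (metis c_def eq_iff_diff_eq_0 mult.left_commute mult.right_neutral)
  \<comment> \<open>After the rotation the chord runs from 1 to \<open>1 + c\<close> in the closed
    disk, which forces \<open>Re c < 0\<close>.\<close>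
  have "cmod (c + 1) \<le> 1" using klein_norm_le_1[of w] v by (simp add: c_def norm_mult)
  then have "(Re c + 1)\<^sup>2 + (Im c)\<^sup>2 \<le> 1"
    by (metis abs_square_le_1 abs_norm_cancel cmod_power2 plus_complex.sel one_complex.sel add_0_right)
  then have "2 * Re c + ((Re c)\<^sup>2 + (Im c)\<^sup>2) \<le> 0" by (simp add: power2_eq_square algebra_simps)
  moreover have "0 < (Re c)\<^sup>2 + (Im c)\<^sup>2" using c0 by (simp add: complex_neq_0)
  ultimately have c: "Re c < 0" by linarith
  define k where "k = - Im c / (2 * Re c)"
  \<comment> \<open>The unit vector at distance \<open>r\<close> from \<open>v\<close>:
    \<open>Im e = k |e|^2\<close> gives the imaginary part, and the root is negative because the
    segment enters the disk.\<close>
  define f where "f r = v * Complex (- sqrt (1 - (k * r)\<^sup>2)) (k * r)" for r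
  have "sgn (z - v) = f (cmod (z - v))" if z: "z \<in> hyp_seg v w" "z \<noteq> v" for z
  proof -
    obtain s where s: "0 \<le> s" "klein z = klein v + s *\<^sub>R (klein w - klein v)"
      using hyp_seg_klein[OF z(1)] by blast
    define e where "e = cnj v * z - 1"
    have ve: "z - v = v * e" using vv by (simp add: e_def algebra_simps)
    then have ne: "cmod (z - v) = cmod e" using v by (simp add: norm_mult)
    have e0: "e \<noteq> 0" using z ve by auto
    have nz: "cmod z = cmod (1 + e)" using v by (simp add: e_def norm_mult)
    have "cmod z < 1" using z by (simp add: hyp_seg_def)
    then have "(cmod (1 + e))\<^sup>2 < 1" unfolding nz by (simp add: abs_square_less_1)
    then have x: "Re e < 0"
      unfolding cmod_power2 by (simp add: power2_eq_square algebra_simps)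
        (smt (verit) zero_le_square)
    have "cnj v * klein z - 1 = s *\<^sub>R c"
      using vv by (simp add: s(2) kv c_def scaleR_conv_of_real algebra_simps)
    moreover have "cnj v * klein z = (2 / (1 + (cmod z)\<^sup>2)) *\<^sub>R (1 + e)"
      by (simp add: klein_def e_def)
    ultimately have sc: "s *\<^sub>R c = (2 / (1 + (cmod (1 + e))\<^sup>2)) *\<^sub>R (1 + e) - 1"
      by (simp add: nz)
    define m where "m = 1 + (cmod (1 + e))\<^sup>2"
    have m: "0 < m" using one_plus_sq_pos by (simp add: m_def)
    have m2: "m = 2 + 2 * Re e + (cmod e)\<^sup>2"
      unfolding m_def cmod_power2 by (simp add: power2_eq_square algebra_simps)
    have "s * Re c = 2 / m * (1 + Re e) - 1" "s * Im c = 2 / m * Im e"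
      using sc by (simp_all add: complex_eq_iff m_def)
    \<comment> \<open>Eliminating \<open>m * s\<close> between these two equations yields the
      equation of the segment.\<close>
    then have "m * (s * Re c) = - (cmod e)\<^sup>2" "m * (s * Im c) = 2 * Im e"
      using m m2 by (simp_all add: field_simps)
    then have "2 * Im e * Re c = - (cmod e)\<^sup>2 * Im c" by algebra
    then have "Im e = k * (cmod e)\<^sup>2"
      using c by (simp add: k_def field_simps)
    then have im: "Im (sgn e) = k * cmod e"
      using e0 by (simp add: power2_eq_square)
    have "(Re (sgn e))\<^sup>2 + (Im (sgn e))\<^sup>2 = 1"
      using norm_sgn[of e] e0 unfolding cmod_power2[symmetric] by simp
    then have "(- Re (sgn e))\<^sup>2 = 1 - (k * cmod e)\<^sup>2" unfolding im power2_minus by linarith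
    moreover have "0 \<le> - Re (sgn e)" using x by (simp add: divide_le_0_iff)
    ultimately have "Re (sgn e) = - sqrt (1 - (k * cmod e)\<^sup>2)"
      by (metis add.inverse_inverse real_sqrt_unique)
    with im have "sgn e = Complex (- sqrt (1 - (k * cmod e)\<^sup>2)) (k * cmod e)"
      by (metis complex.collapse)
    moreover have "sgn (z - v) = v * sgn e"
      unfolding ve sgn_mult using v by (simp add: sgn_div_norm)
    ultimately show ?thesis by (simp add: f_def ne)
  qed
  then have "\<forall>\<^sub>F z in ?F. f (cmod (z - v)) = sgn (z - v)"
    by (auto simp: eventually_at_filter)
  moreover have "((\<lambda>z. f (cmod (z - v))) \<longlongrightarrow> v * Complex (- sqrt (1 - (k * cmod (v - v))\<^sup>2)) (k * cmod (v - v))) ?F"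
    unfolding f_def by (intro tendsto_intros tendsto_Complex)
  moreover have "v * Complex (- sqrt (1 - (k * cmod (v - v))\<^sup>2)) (k * cmod (v - v)) = - v"
    by (simp add: complex_eq_iff)
  ultimately show "((\<lambda>z. sgn (z - v)) \<longlongrightarrow> - v) ?F"
    using tendsto_cong by force
qed

section \<open>Right angles and the Klein rectangle\<close>

text \<open>An ideal vertex would have angle 0. At an inner vertex, argument pi/2 makes the quotient
  of the directions purely imaginary.\<close>

lemma hyp_angle_right:
  assumes g: "hyp_arc v u g" and h: "hyp_arc v w h"
    and cball: "u \<in> cball 0 1" "v \<in> cball 0 1" "w \<in> cball 0 1"
    and angle: "hyp_angle u v w = pi / 2"
  shows "v \<in> ball 0 1" and "geo_dir v u \<bullet> geo_dir v w = 0"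
proof -
  have "cmod v \<noteq> 1"
  proof
    assume "cmod v = 1"
    then have "hyp_angle u v w = Arg2pi (- v / - v)" and "v \<noteq> 0"
      using hyp_dir_boundary g h cball by (auto simp: hyp_angle_def)
    then have "hyp_angle u v w = 0" by (simp add: Arg2pi_eq_0)
    with angle show False by simp
  qed
  with cball show "v \<in> ball 0 1" by auto
  then have "cmod v < 1" by simp
  define x y where "x = sgn (geo_dir v u)" and "y = sgn (geo_dir v w)"
  have "Arg2pi (x / y) = pi / 2"
    using angle hyp_dir_inside[OF g \<open>cmod v < 1\<close>] hyp_dir_inside[OF h \<open>cmod v < 1\<close>]
    by (simp add: hyp_angle_def x_def y_def)
  then have "x / y = of_real (cmod (x / y)) * exp (\<i> * of_real (pi / 2))"
    using Arg2pi[of "x / y"] unfolding is_Arg_def by metis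
  then have "x / y = of_real (cmod (x / y)) * \<i>"
    by (simp only: cis_conv_exp[symmetric] cis_pi_half)
  then have "Re (x / y) = Re (of_real (cmod (x / y)) * \<i>)"
    by (rule arg_cong)
  then have "Re (x / y) = 0" by simp
  then have "x \<bullet> y = 0"
    by (auto simp: Re_divide inner_complex_def sum_power2_eq_zero_iff)
  then show "geo_dir v u \<bullet> geo_dir v w = 0"
    by (auto simp: x_def y_def sgn_div_norm)
qed

text \<open>In the plane \<open>d\<close> is a real multiple of \<open>\<i> * b\<close>, so
  \<open>b\<close> and \<open>d\<close> span; \<open>c - b - d\<close> is orthogonal to both, hence
  \<open>c = b + d\<close>.\<close>

lemma pythagoras_rectangle:
  fixes b c d :: complex
  assumes "b \<noteq> 0" "d \<noteq> 0" and bd: "b \<bullet> d = 0"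
    and bc: "b \<bullet> c = (cmod b)\<^sup>2" and dc: "d \<bullet> c = (cmod d)\<^sup>2"
  shows "(cmod c)\<^sup>2 = (cmod b)\<^sup>2 + (cmod d)\<^sup>2"
proof -
  define k where "k = ((\<i> * b) \<bullet> d) / (cmod b)\<^sup>2"
  have "(\<i> * b) \<bullet> (k *\<^sub>R (\<i> * b)) = (\<i> * b) \<bullet> d"
    using assms(1) by (simp add: k_def norm_mult flip: power2_norm_eq_inner)
  moreover have "b \<bullet> (k *\<^sub>R (\<i> * b)) = b \<bullet> d"
    unfolding bd by (simp add: inner_complex_def)
  ultimately have d: "d = k *\<^sub>R (\<i> * b)"
    using assms(1) by (intro complex_eq_of_inner[of b]) auto
  then have "k \<noteq> 0" using assms(2) by auto
  have "d \<bullet> c = d \<bullet> (b + d)"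
    using dc bd by (simp add: inner_add_right inner_commute power2_norm_eq_inner)
  then have "(\<i> * b) \<bullet> c = (\<i> * b) \<bullet> (b + d)"
    using \<open>k \<noteq> 0\<close> unfolding d by (simp only: inner_scaleR_left mult_cancel_left) auto
  moreover have "b \<bullet> c = b \<bullet> (b + d)"
    using bc bd by (simp add: inner_add_right power2_norm_eq_inner)
  ultimately have "c = b + d"
    using assms(1) by (intro complex_eq_of_inner[of b]) auto
  then show ?thesis
    using bd by (simp add: power2_norm_eq_inner inner_add_left inner_add_right inner_commute)
qed

theorem corollary1p3:
  fixes v\<^sub>a v\<^sub>b v\<^sub>c v\<^sub>d :: complex and \<phi> d\<^sub>1 d\<^sub>2 L :: real
  assumes "lambert_quadrilateral v\<^sub>a v\<^sub>b v\<^sub>c v\<^sub>d"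
    and "0 \<le> \<phi>" and "\<phi> < pi / 2"
    and "quad_angles v\<^sub>a v\<^sub>b v\<^sub>c v\<^sub>d = [pi / 2, pi / 2, \<phi>, pi / 2]"
    and "d\<^sub>1 = hyp_setdist (hyp_seg v\<^sub>a v\<^sub>d) (hyp_seg v\<^sub>b v\<^sub>c)"
    and "d\<^sub>2 = hyp_setdist (hyp_seg v\<^sub>a v\<^sub>b) (hyp_seg v\<^sub>c v\<^sub>d)"
    and "L = (if v\<^sub>c \<in> sphere 0 1 then 1 else tanh (hyp_dist v\<^sub>a v\<^sub>c))"
  shows "(tanh d\<^sub>1)\<^sup>2 + (tanh d\<^sub>2)\<^sup>2 = L\<^sup>2"
proof -
  let ?a = v\<^sub>a and ?b = v\<^sub>b and ?c = v\<^sub>c and ?d = v\<^sub>d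
  obtain g1 g2 g3 g4 where cball: "?a \<in> cball 0 1" "?b \<in> cball 0 1" "?c \<in> cball 0 1" "?d \<in> cball 0 1"
    and g: "hyp_arc ?a ?b g1" "hyp_arc ?b ?c g2" "hyp_arc ?c ?d g3" "hyp_arc ?d ?a g4"
    using assms(1) unfolding lambert_quadrilateral_def hyp_quadrilateral_def
    by (elim conjE exE) (rule that, simp_all)
  note g' = g[THEN hyp_arc_sym]
  have angles: "hyp_angle ?d ?a ?b = pi / 2" "hyp_angle ?a ?b ?c = pi / 2" "hyp_angle ?c ?d ?a = pi / 2"
    using assms(4) by (auto simp: quad_angles_def)
  note A = hyp_angle_right[OF g'(4) g(1) cball(4,1,2) angles(1)]
  note B = hyp_angle_right[OF g'(1) g(2) cball(1,2,3) angles(2)]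
  note D = hyp_angle_right[OF g'(3) g(4) cball(3,4,1) angles(3)]
  \<comment> \<open>Orthogonality at a vertex passes from the far end of a side to all its points,
    as required by the distance lemma.\<close>
  have seg: "geo_dir v z \<bullet> u = 0" if "z \<in> hyp_seg v w" "geo_dir v w \<bullet> u = 0" for v w z u
    using geo_dir_hyp_seg[OF that(1)] that(2) by (metis inner_scaleR_left mult_zero_right)
  have sub: "hyp_seg v w \<subseteq> ball 0 1" for v w by (auto simp: hyp_seg_def)
  have mem: "?a \<in> hyp_seg ?a ?d" "?b \<in> hyp_seg ?b ?c" "?a \<in> hyp_seg ?a ?b" "?d \<in> hyp_seg ?d ?c"
    using hyp_seg_start g g' A(1) B(1) D(1) by auto
  have d1: "d\<^sub>1 = hyp_dist ?a ?b"
    unfolding assms(5) using A(2) B(2)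
    by (intro hyp_setdist_common_perpendicular A(1) B(1) mem sub) (auto elim!: seg simp: inner_commute)
  \<comment> \<open>The side \<open>J[v_c,v_d]\<close> is read from \<open>v_d\<close>, the foot of
    the common perpendicular \<open>J[v_a,v_d]\<close>.\<close>
  have d2: "d\<^sub>2 = hyp_dist ?a ?d"
    unfolding assms(6) hyp_seg_sym[of ?c] using A(2) D(2)
    by (intro hyp_setdist_common_perpendicular A(1) D(1) mem sub) (auto elim!: seg simp: inner_commute)
  have tanh: "(tanh (hyp_dist ?a z))\<^sup>2 = (cmod (klein_at ?a z))\<^sup>2" if "z \<in> ball 0 1" for z
    using tanh_hyp_dist[OF A(1) that] klein_at_norm[OF A(1), of z] that by auto
  \<comment> \<open>For ideal \<open>v_c\<close> the Klein norm is 1, matching the convention for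
    \<open>L\<close>.\<close>
  have L: "L\<^sup>2 = (cmod (klein_at ?a ?c))\<^sup>2"
    using assms(7) tanh[of ?c] klein_at_norm[OF A(1) cball(3)] cball(3)
    by (auto simp: lorentz_self)
  have "(cmod (klein_at ?a ?c))\<^sup>2 = (cmod (klein_at ?a ?b))\<^sup>2 + (cmod (klein_at ?a ?d))\<^sup>2"
  proof (rule pythagoras_rectangle)
    show "klein_at ?a ?b \<noteq> 0" "klein_at ?a ?d \<noteq> 0"
      using klein_at_eq_0_iff[OF A(1)] cball hyp_arc_neq[OF g(1)] hyp_arc_neq[OF g(4)] by auto
    show "klein_at ?a ?b \<bullet> klein_at ?a ?d = 0"
      using A(2) by (simp add: klein_at_def inner_commute)
    show "klein_at ?a ?b \<bullet> klein_at ?a ?c = (cmod (klein_at ?a ?b))\<^sup>2"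
      using B by (intro klein_at_perp_at_end A(1) cball(3)) (auto simp: inner_commute)
    show "klein_at ?a ?d \<bullet> klein_at ?a ?c = (cmod (klein_at ?a ?d))\<^sup>2"
      using D by (intro klein_at_perp_at_end A(1) cball(3)) auto
  qed
  then show ?thesis
    using tanh A(1) B(1) D(1) by (simp add: d1 d2 L)
qed

end
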